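(* For $n\ge 2$, the numbers $v_{n,c}$ of interior nodes of $BC(1,n)$ at which exactly $c$ chords cross satisfy $$\sum_{c=2}^{n+1} v_{n,c} + 2n+2 = \mathcal{N}(1,n),$$ $$\sum_{c=2}^{n+1} c\, v_{n,c} + n^2+4n+1 = \mathcal{E}(1,n),$$ $$\sum_{c=2}^{n+1} \binom{c}{2} v_{n,c} = \binom{n+1}{2}^2 .$$
   Context: The planar graph $BC(1,n)$, $n\ge 1$: take the rectangle with vertices $(0,0),(n,0),(n,1),(0,1)$, with boundary points $(i,0)$ and $(i,1)$ for $0\le i\le n$ ($2n+2$ points: the four vertices together with $n-1$ equally spaced nodes on each of the two sides of length $n$). Join every pair of these boundary points by a straight line segment (a chord). The nodes of the graph are the $2n+2$ boundary points together with all points of the interior of the rectangle where two or more chords intersect (the interior nodes); the edges are the line segments between consecutive nodes along the chords (including the segments forming the boundary of the rectangle). $\mathcal{N}(1,n)$ denotes the number of nodes and $\mathcal{E}(1,n)$ the number of edges of $BC(1,n)$. For $2\le c\le n+1$, $v_{n,c}$ denotes the number of interior nodes of degree $2c$, i.e. interior nodes through which exactly $c$ chords pass. *)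

theory Defs
  imports "HOL-Analysis.Analysis"
begin

definition rectangle :: "nat \<Rightarrow> (real \<times> real) set" where
  "rectangle n = cbox (0, 0) (real n, 1)"

definition boundary_points :: "nat \<Rightarrow> (real \<times> real) set" where
  "boundary_points n = {(real i, y) | i y. i \<le> n \<and> (y = 0 \<or> y = 1)}"

text \<open>Chords are represented as point sets. Chords joining points on the same long side overlap,
  but only inside the boundary of the rectangle; this does not affect the interior nodes, and the
  edges below are counted without multiplicity.\<close>

definition chords :: "nat \<Rightarrow> (real \<times> real) set set" where
  "chords n = {closed_segment p q | p q.
     p \<in> boundary_points n \<and> q \<in> boundary_points n \<and> p \<noteq> q}"

definition chords_through :: "nat \<Rightarrow> real \<times> real \<Rightarrow> (real \<times> real) set set" where
  "chords_through n p = {s \<in> chords n. p \<in> s}"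

definition interior_nodes :: "nat \<Rightarrow> (real \<times> real) set" where
  "interior_nodes n = {p \<in> interior (rectangle n). 2 \<le> card (chords_through n p)}"

definition BC_nodes :: "nat \<Rightarrow> (real \<times> real) set" where
  "BC_nodes n = boundary_points n \<union> interior_nodes n"

text \<open>Two distinct nodes are consecutive along a chord if both lie on it and no node lies strictly
  between them.\<close>

definition BC_edges :: "nat \<Rightarrow> (real \<times> real) set set" where
  "BC_edges n = {closed_segment p q | p q.
     p \<in> BC_nodes n \<and> q \<in> BC_nodes n \<and> p \<noteq> q \<and>
     (\<exists>s \<in> chords n. p \<in> s \<and> q \<in> s) \<and>
     open_segment p q \<inter> BC_nodes n = {}}"

definition num_nodes :: "nat \<Rightarrow> nat" where
  "num_nodes n = card (BC_nodes n)"

definition num_edges :: "nat \<Rightarrow> nat" where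
  "num_edges n = card (BC_edges n)"

definition num_crossings :: "nat \<Rightarrow> nat \<Rightarrow> nat" where
  "num_crossings n c = card {p \<in> interior_nodes n. card (chords_through n p) = c}"

lemma finite_boundary_points: "finite (boundary_points n)"
proof -
  have "boundary_points n \<subseteq> (real ` {..n}) \<times> {0, 1}"
    unfolding boundary_points_def by auto
  then show ?thesis
    by (rule finite_subset) auto
qed

lemma finite_chords: "finite (chords n)"
proof -
  have "chords n \<subseteq> (\<lambda>(p, q). closed_segment p q) ` (boundary_points n \<times> boundary_points n)"
    unfolding chords_def by auto
  then show ?thesis
    by (rule finite_subset) (simp add: finite_boundary_points)
qed

end

theory Submission imports Defs begin

text \<open>Only the $(n+1)^2$ transversal chords, joining the two long sides, meet the interior of the
  rectangle. A transversal carrying $k$ interior nodes is cut into $k+1$ edges, and each long side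
  into $n$; double counting incidences of interior nodes and transversals gives the edge formula.
  Two transversals $(a,0)(b,1)$ and $(a',0)(b',1)$ with $a<a'$ cross in the interior iff $b'<b$, so
  each choice of two lower and two upper points yields exactly one crossing pair; counting these
  pairs by their crossing point gives the last formula.\<close>

section \<open>Consecutive points on a segment\<close>

text \<open>Every element except the minimum is the right end of exactly one gap, whose left end is
  the largest element below it. For empty \<open>S\<close> the truncated subtraction gives
  0.\<close>

lemma card_consecutive_pairs:
  fixes S :: "'a::linorder set"
  assumes "finite S"
  shows "card {(s, t). s \<in> S \<and> t \<in> S \<and> s < t \<and> {s<..<t} \<inter> S = {}} = card S - 1"
proof (cases "S = {}")
  case False
  let ?P = "{(s, t). s \<in> S \<and> t \<in> S \<and> s < t \<and> {s<..<t} \<inter> S = {}}"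
  have "bij_betw snd ?P (S - {Min S})"
  proof (rule bij_betw_imageI)
    show "inj_on snd ?P"
    proof (rule inj_onI, clarsimp)
      fix s s' t
      assume "s \<in> S" "s' \<in> S" "s < t" "s' < t" "{s<..<t} \<inter> S = {}" "{s'<..<t} \<inter> S = {}"
      then show "s = s'"
        by (metis disjoint_iff greaterThanLessThan_iff linorder_neqE)
    qed
    show "snd ` ?P = S - {Min S}"
    proof (intro equalityI subsetI)
      fix t assume "t \<in> snd ` ?P"
      then obtain s where "s \<in> S" "t \<in> S" "s < t" by auto
      then show "t \<in> S - {Min S}"
        using Min_le[OF assms \<open>s \<in> S\<close>] by auto
    next
      fix t assume t: "t \<in> S - {Min S}"
      let ?L = "{x \<in> S. x < t}"
      have fin: "finite ?L" using assms by simp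
      have "Min S < t"
        using t Min_le[OF assms, of t] by auto
      then have "?L \<noteq> {}" using Min_in[OF assms False] by auto
      then have M: "Max ?L \<in> ?L" using Max_in[OF fin] by blast
      moreover have "{Max ?L<..<t} \<inter> S = {}"
      proof -
        have "x \<le> Max ?L" if "x \<in> S" "x < t" for x
          using that fin by (intro Max_ge) auto
        then show ?thesis by force
      qed
      ultimately have "(Max ?L, t) \<in> ?P" using t by auto
      then show "t \<in> snd ` ?P" by force
    qed
  qed
  then have "card ?P = card (S - {Min S})" by (rule bij_betw_same_card)
  then show ?thesis using assms False by simp
qed simp

text \<open>The edge condition of \<open>BC_edges\<close>, isolated for one line \<open>s\<close>,
  so that edges can be counted line by line.\<close>

definition consecutive_segments :: "'a::euclidean_space set \<Rightarrow> 'a set \<Rightarrow> 'a set set" where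
  "consecutive_segments N s = {closed_segment p q | p q.
     p \<in> N \<and> q \<in> N \<and> p \<noteq> q \<and> p \<in> s \<and> q \<in> s \<and> open_segment p q \<inter> N = {}}"

text \<open>The affine parametrization of the segment by \<open>{0..1}\<close> reduces the count to
  gaps in a finite set of reals; \<open>u \<noteq> v\<close> makes it injective.\<close>

lemma card_consecutive_segments:
  assumes "finite N" "u \<noteq> v"
  shows "card (consecutive_segments N (closed_segment u v)) = card (N \<inter> closed_segment u v) - 1"
proof -
  define \<gamma> where "\<gamma> = (\<lambda>t::real. u + t *\<^sub>R (v - u))"
  have lin: "linear (\<lambda>t::real. t *\<^sub>R (v - u))" by (simp add: linear_scaleR_left)
  have inj: "inj \<gamma>" using assms by (auto simp: inj_on_def \<gamma>_def)
  have closed: "closed_segment (\<gamma> s) (\<gamma> t) = \<gamma> ` closed_segment s t" for s t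
    using closed_segment_translation[of u "s *\<^sub>R (v - u)" "t *\<^sub>R (v - u)"]
      closed_segment_linear_image[OF lin, of s t]
    by (simp add: \<gamma>_def image_image)
  have open_seg: "open_segment (\<gamma> s) (\<gamma> t) = \<gamma> ` open_segment s t" for s t
    unfolding open_segment_def closed by (subst image_set_diff[OF inj]) simp
  have uv: "closed_segment u v = \<gamma> ` {0..1}"
    using closed[of 0 1] by (simp add: \<gamma>_def closed_segment_eq_real_ivl)
  define S where "S = {t \<in> {0..1}. \<gamma> t \<in> N}"
  have NS: "N \<inter> closed_segment u v = \<gamma> ` S" unfolding uv S_def by auto
  have "finite (\<gamma> ` S)" using assms NS by (metis finite_Int)
  then have "finite S" using inj by (meson finite_imageD inj_on_subset subset_UNIV)
  define P where "P = {(s, t). s \<in> S \<and> t \<in> S \<and> s < t \<and> {s<..<t} \<inter> S = {}}"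
  have gap: "open_segment (\<gamma> s) (\<gamma> t) \<inter> N = {} \<longleftrightarrow> {s<..<t} \<inter> S = {}"
    if "s \<in> S" "t \<in> S" "s < t" for s t
    using that unfolding open_seg S_def by (auto simp: open_segment_eq_real_ivl)
  have "consecutive_segments N (closed_segment u v) = (\<lambda>(s, t). \<gamma> ` {s..t}) ` P"
  proof (intro equalityI subsetI)
    fix e assume "e \<in> consecutive_segments N (closed_segment u v)"
    then obtain p q where e: "e = closed_segment p q" "p \<in> N \<inter> closed_segment u v"
      "q \<in> N \<inter> closed_segment u v" "p \<noteq> q" "open_segment p q \<inter> N = {}"
      unfolding consecutive_segments_def by auto
    then obtain s t where st: "s \<in> S" "t \<in> S" "p = \<gamma> s" "q = \<gamma> t" unfolding NS by auto
    then have "s \<noteq> t" using e by auto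
    \<comment> \<open>A segment has no orientation, while the pairs in \<open>P\<close> are
      increasing, so both orders must be matched.\<close>
    then consider "s < t" | "t < s" by linarith
    then show "e \<in> (\<lambda>(s, t). \<gamma> ` {s..t}) ` P"
    proof cases
      case 1
      then have "(s, t) \<in> P" using gap[of s t] st e by (auto simp: P_def)
      moreover have "e = \<gamma> ` {s..t}"
        using e st 1 closed[of s t] by (simp add: closed_segment_eq_real_ivl)
      ultimately show ?thesis by force
    next
      case 2
      then have "(t, s) \<in> P"
        using gap[of t s] st e by (auto simp: P_def open_segment_commute)
      moreover have "e = \<gamma> ` {t..s}"
        using e st 2 closed[of s t] by (simp add: closed_segment_eq_real_ivl)
      ultimately show ?thesis by force
    qed
  next
    fix e assume "e \<in> (\<lambda>(s, t). \<gamma> ` {s..t}) ` P"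
    then obtain s t where st: "s \<in> S" "t \<in> S" "s < t" "{s<..<t} \<inter> S = {}" "e = \<gamma> ` {s..t}"
      by (auto simp: P_def)
    moreover have "e = closed_segment (\<gamma> s) (\<gamma> t)"
      using st closed[of s t] by (simp add: closed_segment_eq_real_ivl)
    moreover have "\<gamma> s \<noteq> \<gamma> t" using st inj by (auto dest: injD)
    moreover have "\<gamma> s \<in> N \<inter> closed_segment u v" "\<gamma> t \<in> N \<inter> closed_segment u v"
      using st NS by auto
    ultimately show "e \<in> consecutive_segments N (closed_segment u v)"
      using gap[of s t] unfolding consecutive_segments_def by blast
  qed
  moreover have "inj_on (\<lambda>(s, t). \<gamma> ` {s..t}) P"
    by (auto simp: inj_on_def P_def inj_image_eq_iff[OF inj] Icc_eq_Icc)
  ultimately have "card (consecutive_segments N (closed_segment u v)) = card P"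
    by (simp add: card_image)
  also have "\<dots> = card S - 1" unfolding P_def by (rule card_consecutive_pairs[OF \<open>finite S\<close>])
  also have "card S = card (N \<inter> closed_segment u v)"
    unfolding NS using inj by (metis card_image inj_on_subset subset_UNIV)
  finally show ?thesis .
qed

section \<open>Transversal chords\<close>

definition transversal :: "nat \<Rightarrow> nat \<Rightarrow> (real \<times> real) set" where
  "transversal a b = closed_segment (real a, 0) (real b, 1)"

definition transversals :: "nat \<Rightarrow> (real \<times> real) set set" where
  "transversals n = (\<lambda>(a, b). transversal a b) ` ({..n} \<times> {..n})"

text \<open>The height \<open>y\<close> is itself the segment parameter, so a transversal has
  exactly one point at each height in \<open>{0..1}\<close>.\<close>

lemma mem_transversal:
  "(x, y) \<in> transversal a b \<longleftrightarrow> 0 \<le> y \<and> y \<le> 1 \<and> x = (1 - y) * real a + y * real b"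
  by (auto simp: transversal_def in_segment)

text \<open>The points at heights 0 and 1 recover the indices; hence transversals, although point
  sets, can be counted as index pairs.\<close>

lemma transversal_eq_iff: "transversal a b = transversal a' b' \<longleftrightarrow> a = a' \<and> b = b'"
proof
  assume *: "transversal a b = transversal a' b'"
  have "(real a, 0) \<in> transversal a b" "(real b, 1) \<in> transversal a b"
    by (auto simp: mem_transversal)
  then show "a = a' \<and> b = b'" unfolding * by (auto simp: mem_transversal)
qed simp

lemma inj_on_transversal: "inj_on (\<lambda>(a, b). transversal a b) A"
  by (auto simp: inj_on_def transversal_eq_iff)

lemma finite_transversals: "finite (transversals n)"
  by (simp add: transversals_def)

lemma card_transversals: "card (transversals n) = (n + 1)^2"
  by (simp add: transversals_def card_image[OF inj_on_transversal] power2_eq_square)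

text \<open>The horizontal offset of two transversals is an affine function of the height; vanishing
  at two heights, it vanishes identically.\<close>

lemma transversals_Int_unique:
  assumes "p \<in> transversal a b" "p \<in> transversal a' b'" "q \<in> transversal a b"
    "q \<in> transversal a' b'" "p \<noteq> q"
  shows "transversal a b = transversal a' b'"
proof -
  obtain x y z w where pq: "p = (x, y)" "q = (z, w)" by (metis surj_pair)
  let ?f = "\<lambda>y. (1 - y) * (real a - real a') + y * (real b - real b')"
  have "?f y = 0" "?f w = 0" "y \<noteq> w"
    using assms unfolding pq mem_transversal by (auto simp: algebra_simps)
  \<comment> \<open>Cramer's rule for the linear system in the two endpoint differences, with
    determinant \<open>w - y\<close>.\<close>
  have "(w - y) * (real a - real a') = w * ?f y - y * ?f w"
    "(w - y) * (real b - real b') = (1 - y) * ?f w - (1 - w) * ?f y"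
    by algebra+
  then have "real a = real a'" "real b = real b'"
    using \<open>?f y = 0\<close> \<open>?f w = 0\<close> \<open>y \<noteq> w\<close> by auto
  then show ?thesis by simp
qed

section \<open>The rectangle and the classification of its chords\<close>

lemma interior_rectangle: "interior (rectangle n) = {0<..<real n} \<times> {0<..<1}"
  unfolding rectangle_def interior_cbox by (auto simp: box_def Basis_prod_def)

lemma boundary_points_eq: "boundary_points n = (\<lambda>i. (real i, 0)) ` {..n} \<union> (\<lambda>i. (real i, 1)) ` {..n}"
  by (auto simp: boundary_points_def)

lemma mem_horizontal:
  fixes z :: real
  shows "(x, y) \<in> closed_segment (0, z) (real n, z) \<longleftrightarrow> y = z \<and> 0 \<le> x \<and> x \<le> real n"
proof
  assume "(x, y) \<in> closed_segment (0, z) (real n, z)"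
  then show "y = z \<and> 0 \<le> x \<and> x \<le> real n"
    by (auto simp: in_segment mult_left_le_one_le algebra_simps)
next
  assume "y = z \<and> 0 \<le> x \<and> x \<le> real n"
  then show "(x, y) \<in> closed_segment (0, z) (real n, z)"
    by (cases "n = 0") (auto simp: in_segment algebra_simps intro!: exI[of _ "x / real n"])
qed

text \<open>The case is decided by the heights of the two endpoints. Horizontal chords may overlap,
  so only their inclusion in a long side is recorded.\<close>

lemma chord_cases:
  assumes "s \<in> chords n"
  obtains (trans) "s \<in> transversals n"
    | (bottom) "s \<subseteq> closed_segment (0, 0) (real n, 0)"
    | (top) "s \<subseteq> closed_segment (0, 1) (real n, 1)"
proof -
  have sub: "closed_segment (real i, y) (real j, y) \<subseteq> closed_segment (0, y) (real n, y)"
    if "i \<le> n" "j \<le> n" for i j and y :: real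
    using that by (intro closed_segment_subset) (auto simp: mem_horizontal)
  have tr: "transversal i j \<in> transversals n" if "i \<le> n" "j \<le> n" for i j
    using that by (auto simp: transversals_def)
  obtain p q where pq: "s = closed_segment p q" "p \<in> boundary_points n" "q \<in> boundary_points n"
    using assms by (auto simp: chords_def)
  then obtain i y j z where ij: "p = (real i, y)" "q = (real j, z)" "i \<le> n" "j \<le> n"
      "y = 0 \<or> y = 1" "z = 0 \<or> z = 1"
    by (auto simp: boundary_points_def)
  then consider "y = 0" "z = 0" | "y = 1" "z = 1" | "y = 0" "z = 1" | "y = 1" "z = 0" by blast
  then show thesis
  proof cases
    case 1 then show ?thesis using sub[of i j 0] pq ij bottom by auto
  next
    case 2 then show ?thesis using sub[of i j 1] pq ij top by auto
  next
    case 3 then show ?thesis using tr[of i j] pq ij trans by (auto simp: transversal_def)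
  next
    case 4 then show ?thesis
      using tr[of j i] pq ij trans by (auto simp: transversal_def closed_segment_commute)
  qed
qed

lemma transversals_subset_chords: "transversals n \<subseteq> chords n"
proof
  fix s assume "s \<in> transversals n"
  then obtain a b where "a \<le> n" "b \<le> n" "s = closed_segment (real a, 0) (real b, 1)"
    by (auto simp: transversals_def transversal_def)
  then show "s \<in> chords n"
    unfolding chords_def by (intro CollectI exI conjI) (auto simp: boundary_points_def)
qed

text \<open>A horizontal chord has height 0 or 1, whereas an interior point lies strictly
  between.\<close>

lemma chords_through_interior:
  assumes "p \<in> interior (rectangle n)"
  shows "chords_through n p = {s \<in> transversals n. p \<in> s}"
proof -
  have "s \<in> transversals n" if "s \<in> chords n" "p \<in> s" for s
    using that(1)
  proof (cases rule: chord_cases)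
    case bottom
    then have "p \<in> closed_segment (0, 0) (real n, 0)" using that by blast
    then have "snd p = 0" using mem_horizontal[of "fst p" "snd p" 0 n] by simp
    then show ?thesis using assms by (auto simp: interior_rectangle)
  next
    case top
    then have "p \<in> closed_segment (0, 1) (real n, 1)" using that by blast
    then have "snd p = 1" using mem_horizontal[of "fst p" "snd p" 1 n] by simp
    then show ?thesis using assms by (auto simp: interior_rectangle)
  qed
  then show ?thesis using transversals_subset_chords by (auto simp: chords_through_def)
qed

section \<open>Interior nodes\<close>

lemma interior_node_ex_transversals:
  assumes "p \<in> interior_nodes n"
  obtains s s' where "s \<in> transversals n" "s' \<in> transversals n" "s \<noteq> s'" "p \<in> s" "p \<in> s'"
proof -
  have p: "p \<in> interior (rectangle n)" "2 \<le> card (chords_through n p)"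
    using assms by (auto simp: interior_nodes_def)
  then obtain U where U: "U \<subseteq> chords_through n p" "card U = 2"
    by (metis obtain_subset_with_card_n)
  then obtain s s' where "U = {s, s'}" "s \<noteq> s'" by (auto simp: card_2_iff)
  then show ?thesis using U chords_through_interior[OF p(1)] that by auto
qed

text \<open>Contrapositive of \<open>transversals_Int_unique\<close>, for members of
  \<open>transversals n\<close>. It identifies a node from two of its chords and later separates the
  edges of different lines.\<close>

lemma interior_nodes_eqI:
  assumes "s \<in> transversals n" "s' \<in> transversals n" "s \<noteq> s'"
    "p \<in> s" "p \<in> s'" "q \<in> s" "q \<in> s'"
  shows "p = q"
proof -
  obtain a b a' b' where "s = transversal a b" "s' = transversal a' b'"
    using assms(1,2) by (auto simp: transversals_def)
  then show ?thesis using assms(3-) transversals_Int_unique by metis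
qed

lemma finite_interior_nodes: "finite (interior_nodes n)"
proof -
  \<comment> \<open>A node is the unique common point of two transversals. On pairs without one the
    value is arbitrary, which is harmless since only an inclusion is claimed.\<close>
  let ?f = "\<lambda>(s, s'). THE p. p \<in> s \<and> p \<in> s'"
  have "interior_nodes n \<subseteq> ?f ` (transversals n \<times> transversals n)"
  proof
    fix p assume "p \<in> interior_nodes n"
    then obtain s s' where s: "s \<in> transversals n" "s' \<in> transversals n" "s \<noteq> s'" "p \<in> s" "p \<in> s'"
      by (rule interior_node_ex_transversals)
    have "(THE p. p \<in> s \<and> p \<in> s') = p"
      by (rule the_equality) (use s interior_nodes_eqI[OF s(1-3)] in blast)+
    then have f: "?f (s, s') = p" by simp
    have "?f (s, s') \<in> ?f ` (transversals n \<times> transversals n)"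
      using s by (intro imageI SigmaI)
    then show "p \<in> ?f ` (transversals n \<times> transversals n)" unfolding f .
  qed
  then show ?thesis by (rule finite_subset) (simp add: finite_transversals)
qed

text \<open>Through a point of positive height, the lower endpoint determines the transversal, and
  there are \<open>n + 1\<close> lower endpoints. This is the source of the upper limit
  \<open>n + 1\<close> of the sums.\<close>

lemma card_chords_through_le:
  assumes "p \<in> interior (rectangle n)"
  shows "card (chords_through n p) \<le> n + 1"
proof -
  obtain x y where p: "p = (x, y)" "0 < y" "y < 1"
    using assms by (auto simp: interior_rectangle)
  define A where "A = {(a, b). a \<le> n \<and> b \<le> n \<and> p \<in> transversal a b}"
  have "chords_through n p = (\<lambda>(a, b). transversal a b) ` A"
    by (auto simp: chords_through_interior[OF assms] transversals_def A_def)
  then have "card (chords_through n p) = card A" by (simp add: card_image[OF inj_on_transversal])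
  also have "card A = card (fst ` A)"
  proof (rule card_image[symmetric], rule inj_onI)
    fix r r' assume "r \<in> A" "r' \<in> A" "fst r = fst r'"
    then show "r = r'" using p by (auto simp: A_def mem_transversal)
  qed
  also have "\<dots> \<le> card {..n}" by (rule card_mono) (auto simp: A_def)
  finally show ?thesis by simp
qed

text \<open>Grouping the nodes by their number of chords turns each sum over \<open>c\<close> into a
  sum over nodes. The weight \<open>f\<close> is kept general to serve all three identities.\<close>

lemma sum_num_crossings:
  "(\<Sum>c = 2..n+1. f c * num_crossings n c) = (\<Sum>p\<in>interior_nodes n. f (card (chords_through n p)))"
proof -
  have "(\<Sum>p\<in>interior_nodes n. f (card (chords_through n p)))
      = (\<Sum>c = 2..n+1. \<Sum>p | p \<in> interior_nodes n \<and> card (chords_through n p) = c.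
           f (card (chords_through n p)))"
    using card_chords_through_le
    by (intro sum.group[symmetric] finite_interior_nodes) (auto simp: interior_nodes_def)
  also have "\<dots> = (\<Sum>c = 2..n+1. f c * num_crossings n c)"
    by (intro sum.cong) (auto simp: num_crossings_def)
  finally show ?thesis by simp
qed

section \<open>Counting nodes\<close>

lemma card_boundary_points: "card (boundary_points n) = 2 * n + 2"
proof -
  have "card (boundary_points n)
      = card ((\<lambda>i. (real i, 0::real)) ` {..n}) + card ((\<lambda>i. (real i, 1::real)) ` {..n})"
    unfolding boundary_points_eq by (rule card_Un_disjoint) auto
  then show ?thesis by (simp add: card_image inj_on_def)
qed

lemma finite_BC_nodes: "finite (BC_nodes n)"
  by (simp add: BC_nodes_def finite_boundary_points finite_interior_nodes)

lemma num_nodes_eq: "num_nodes n = card (interior_nodes n) + 2 * n + 2"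
proof -
  have "boundary_points n \<inter> interior_nodes n = {}"
    by (auto simp: boundary_points_def interior_nodes_def interior_rectangle)
  then show ?thesis
    by (simp add: num_nodes_def BC_nodes_def card_Un_disjoint finite_boundary_points
        finite_interior_nodes card_boundary_points)
qed

section \<open>Counting edges\<close>

text \<open>Only the long sides: the short ones are already the transversals
  \<open>transversal 0 0\<close> and \<open>transversal n n\<close>.\<close>

definition sides :: "nat \<Rightarrow> (real \<times> real) set set" where
  "sides n = {closed_segment (0, 0) (real n, 0), closed_segment (0, 1) (real n, 1)}"

lemma sides_eq: "sides n = (\<lambda>z. closed_segment (0, z) (real n, z)) ` {0, 1}"
  by (simp add: sides_def)

lemma sides_subset_chords:
  assumes "n \<ge> 1"
  shows "sides n \<subseteq> chords n"
proof
  fix s assume "s \<in> sides n"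
  then obtain z where z: "z = 0 \<or> z = 1" "s = closed_segment (real 0, z) (real n, z)"
    by (auto simp: sides_def)
  then show "s \<in> chords n"
    using assms unfolding chords_def
    by (intro CollectI exI conjI) (auto simp: boundary_points_def)
qed

text \<open>Every chord lies inside a transversal or a long side, and these are chords themselves.
  Restricting to them removes the overlaps among horizontal chords.\<close>

lemma BC_edges_eq:
  assumes "n \<ge> 1"
  shows "BC_edges n = (\<Union>s \<in> transversals n \<union> sides n. consecutive_segments (BC_nodes n) s)"
proof -
  have "\<exists>s' \<in> transversals n \<union> sides n. s \<subseteq> s'" if "s \<in> chords n" for s
    using that by (cases rule: chord_cases) (auto simp: sides_def)
  moreover have "transversals n \<union> sides n \<subseteq> chords n"
    using transversals_subset_chords sides_subset_chords[OF assms] by blast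
  ultimately have on_chord: "(\<exists>s \<in> chords n. p \<in> s \<and> q \<in> s)
      \<longleftrightarrow> (\<exists>s \<in> transversals n \<union> sides n. p \<in> s \<and> q \<in> s)" for p q
    by (meson in_mono)
  show ?thesis unfolding BC_edges_def consecutive_segments_def on_chord by blast
qed

text \<open>Distinct points have different heights on a transversal and equal heights on a long
  side, so the two kinds cannot share two points. Within each kind, two transversals meet at most
  once and the two sides are disjoint.\<close>

lemma lines_Int_unique:
  assumes "s \<in> transversals n \<union> sides n" "s' \<in> transversals n \<union> sides n"
    "p \<in> s" "p \<in> s'" "q \<in> s" "q \<in> s'" "p \<noteq> q"
  shows "s = s'"
proof -
  have level: "snd r = z" if "r \<in> closed_segment (0, z) (real n, z)" for r and z :: real
    using that mem_horizontal[of "fst r" "snd r" z n] by simp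
  have steep: "snd p \<noteq> snd q" if "t \<in> transversals n" "p \<in> t" "q \<in> t" for t
    using that \<open>p \<noteq> q\<close> by (cases p; cases q) (auto simp: transversals_def mem_transversal)
  show ?thesis
  proof (cases "s \<in> transversals n \<and> s' \<in> transversals n")
    case True
    then show ?thesis using assms interior_nodes_eqI by blast
  next
    case False
    with assms(1,2) consider "s \<in> sides n" | "s' \<in> sides n" by blast
    then have flat: "snd p = snd q"
      by cases (use assms(3-6) in \<open>auto simp: sides_eq dest!: level\<close>)
    then have "s \<in> sides n" "s' \<in> sides n" using assms steep by auto
    then obtain z z' where z: "s = closed_segment (0, z) (real n, z)"
        "s' = closed_segment (0, z') (real n, z')"
      by (auto simp: sides_eq)
    then have "z = z'" using level[of p z] level[of p z'] assms(3,4) by simp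
    then show ?thesis using z by simp
  qed
qed

lemma consecutive_segments_disjoint:
  assumes "s \<in> transversals n \<union> sides n" "s' \<in> transversals n \<union> sides n" "s \<noteq> s'"
  shows "consecutive_segments N s \<inter> consecutive_segments N s' = {}"
proof (rule ccontr)
  assume "consecutive_segments N s \<inter> consecutive_segments N s' \<noteq> {}"
  then obtain p q p' q' where *: "closed_segment p q = closed_segment p' q'" "p \<noteq> q"
      "p \<in> s" "q \<in> s" "p' \<in> s'" "q' \<in> s'"
    unfolding consecutive_segments_def by blast
  \<comment> \<open>An edge, as a set, determines its two endpoints; these would be two common
    points of different lines.\<close>
  then have "{p, q} = {p', q'}" by (simp add: closed_segment_eq)
  then have "p \<in> s'" "q \<in> s'" using * by auto
  then show False using assms * lines_Int_unique by blast
qed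

lemma finite_consecutive_segments: "finite N \<Longrightarrow> finite (consecutive_segments N s)"
  by (rule finite_subset[of _ "(\<lambda>(p, q). closed_segment p q) ` (N \<times> N)"])
    (auto simp: consecutive_segments_def)

text \<open>The summand 2 accounts for the ends of the transversal, its only boundary points among
  the nodes.\<close>

lemma card_BC_nodes_Int_transversal:
  assumes "s \<in> transversals n"
  shows "card (BC_nodes n \<inter> s) = card (interior_nodes n \<inter> s) + 2"
proof -
  obtain a b where ab: "a \<le> n" "b \<le> n" "s = transversal a b"
    using assms by (auto simp: transversals_def)
  have "boundary_points n \<inter> s = {(real a, 0), (real b, 1)}"
    using ab by (auto simp: boundary_points_eq mem_transversal)
  moreover have "boundary_points n \<inter> interior_nodes n = {}"
    by (auto simp: boundary_points_def interior_nodes_def interior_rectangle)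
  moreover have "BC_nodes n \<inter> s = (interior_nodes n \<inter> s) \<union> (boundary_points n \<inter> s)"
    by (auto simp: BC_nodes_def)
  moreover have "card ((interior_nodes n \<inter> s) \<union> (boundary_points n \<inter> s))
      = card (interior_nodes n \<inter> s) + card (boundary_points n \<inter> s)"
    using calculation(2)
    by (intro card_Un_disjoint) (auto simp: finite_interior_nodes finite_boundary_points)
  ultimately show ?thesis by simp
qed

lemma card_BC_nodes_Int_side:
  assumes "s \<in> sides n"
  shows "card (BC_nodes n \<inter> s) = n + 1"
proof -
  obtain z where z: "z = 0 \<or> z = 1" "s = closed_segment (0, z) (real n, z)"
    using assms by (auto simp: sides_eq)
  then have "BC_nodes n \<inter> s = (\<lambda>i. (real i, z)) ` {..n}"
    by (auto simp: BC_nodes_def boundary_points_eq interior_nodes_def interior_rectangle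
        mem_horizontal)
  then show ?thesis by (simp add: card_image inj_on_def)
qed

lemma sum_card_interior_nodes:
  "(\<Sum>s\<in>transversals n. card (interior_nodes n \<inter> s))
    = (\<Sum>p\<in>interior_nodes n. card (chords_through n p))"
proof -
  have "(\<Sum>s\<in>transversals n. card (interior_nodes n \<inter> s))
      = (\<Sum>s\<in>transversals n. \<Sum>p\<in>interior_nodes n. if p \<in> s then 1 else 0)"
    by (simp add: sum.If_cases finite_interior_nodes)
  also have "\<dots> = (\<Sum>p\<in>interior_nodes n. \<Sum>s\<in>transversals n. if p \<in> s then 1 else 0)"
    by (rule sum.swap)
  also have "\<dots> = (\<Sum>p\<in>interior_nodes n. card (chords_through n p))"
    by (intro sum.cong)
      (auto simp: sum.If_cases finite_transversals chords_through_interior interior_nodes_def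
        Int_def)
  finally show ?thesis .
qed

text \<open>The constant is \<open>(n + 1)^2 + 2 * n\<close>: one edge more than its interior nodes
  for each transversal, and \<open>n\<close> edges for each long side.\<close>

lemma num_edges_eq:
  assumes "n \<ge> 1"
  shows "num_edges n = (\<Sum>p\<in>interior_nodes n. card (chords_through n p)) + n^2 + 4 * n + 1"
proof -
  let ?E = "consecutive_segments (BC_nodes n)"
  have disj: "transversals n \<inter> sides n = {}"
  proof -
    have "\<not> transversal a b \<in> sides n" for a b
    proof
      assume "transversal a b \<in> sides n"
      moreover have "(real a, 0) \<in> transversal a b" "(real b, 1) \<in> transversal a b"
        by (auto simp: mem_transversal)
      ultimately show False by (auto simp: sides_def mem_horizontal)
    qed
    then show ?thesis by (auto simp: transversals_def)
  qed
  have "closed_segment (0, 0) (real n, 0) \<noteq> closed_segment (0, 1) (real n, 1::real)"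
    by (simp add: closed_segment_eq doubleton_eq_iff)
  then have card_sides: "card (sides n) = 2" by (simp add: sides_def)
  have trans: "card (?E s) = card (interior_nodes n \<inter> s) + 1" if "s \<in> transversals n" for s
  proof -
    obtain a b where "s = closed_segment (real a, 0) (real b, 1)"
      using \<open>s \<in> transversals n\<close> by (auto simp: transversals_def transversal_def)
    then have "card (?E s) = card (BC_nodes n \<inter> s) - 1"
      by (simp add: card_consecutive_segments finite_BC_nodes)
    then show ?thesis using card_BC_nodes_Int_transversal[OF that] by simp
  qed
  have side: "card (?E s) = n" if "s \<in> sides n" for s
  proof -
    have "card (?E s) = card (BC_nodes n \<inter> s) - 1"
      using that assms card_consecutive_segments[OF finite_BC_nodes] by (auto simp: sides_def)
    then show ?thesis using card_BC_nodes_Int_side[OF that] by simp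
  qed
  have "num_edges n = (\<Sum>s\<in>transversals n \<union> sides n. card (?E s))"
    unfolding num_edges_def BC_edges_eq[OF assms]
    using consecutive_segments_disjoint
    by (intro card_UN_disjoint)
      (auto simp: finite_transversals sides_def finite_consecutive_segments finite_BC_nodes)
  also have "\<dots> = (\<Sum>s\<in>transversals n. card (?E s)) + (\<Sum>s\<in>sides n. card (?E s))"
    using disj by (intro sum.union_disjoint) (auto simp: finite_transversals sides_def)
  also have "\<dots> = (\<Sum>s\<in>transversals n. card (interior_nodes n \<inter> s)) + (n + 1)^2 + 2 * n"
    using card_transversals[of n] by (simp add: trans side sum_Suc card_sides)
  finally show ?thesis
    by (simp add: sum_card_interior_nodes power2_eq_square)
qed

section \<open>Counting crossing pairs\<close>

lemma card_increasing_pairs: "card {(a, a'). a < a' \<and> a' \<le> n} = (n + 1) choose 2"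
proof -
  \<comment> \<open>Counting by the larger entry: \<open>a'\<close> has exactly \<open>a'\<close>
    smaller partners. The converse is taken because \<open>SIGMA\<close> puts the larger entry
    first.\<close>
  have "{(a, a'). a < a' \<and> a' \<le> n} = (SIGMA a' : {..n}. {..<a'})\<inverse>" by auto
  then have "card {(a, a'). a < a' \<and> a' \<le> n} = (\<Sum>a'\<le>n. a')"
    by (simp add: card_inverse)
  also have "\<dots> = (n + 1) choose 2"
    by (induction n) (auto simp: numeral_2_eq_2)
  finally show ?thesis .
qed

text \<open>The horizontal offset is affine in the height. As the second chord starts to the right
  of the first, the offset vanishes strictly between the long sides iff that chord ends to the
  left.\<close>

lemma transversals_cross_iff:
  assumes "a \<le> n" "b \<le> n" "a' \<le> n" "b' \<le> n" "a < a'"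
  shows "(\<exists>p \<in> interior (rectangle n). p \<in> transversal a b \<and> p \<in> transversal a' b') \<longleftrightarrow> b' < b"
proof
  assume "\<exists>p \<in> interior (rectangle n). p \<in> transversal a b \<and> p \<in> transversal a' b'"
  then obtain y :: real where y: "0 < y" "y < 1"
      "(1 - y) * real a + y * real b = (1 - y) * real a' + y * real b'"
    by (auto simp: interior_rectangle mem_transversal)
  moreover have "(1 - y) * real a < (1 - y) * real a'" using y assms by simp
  ultimately have "y * real b' < y * real b" by linarith
  then show "b' < b" using y by simp
next
  assume "b' < b"
  \<comment> \<open>The crossing height solves \<open>(1 - y) * (a' - a) = y * (b - b')\<close>.
    Both natural differences are genuine because \<open>a < a'\<close> and
    \<open>b' < b\<close>.\<close>
  define d where "d = real (a' - a) + real (b - b')"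
  define y where "y = real (a' - a) / d"
  have d: "d > 0" "real (a' - a) > 0" "real (b - b') > 0"
    using assms \<open>b' < b\<close> by (auto simp: d_def)
  have y: "0 < y" "y < 1" using d by (auto simp: y_def d_def)
  let ?x = "(1 - y) * real a + y * real b"
  have "y * d = real a' - real a" using d assms by (simp add: y_def)
  then have "y * (real b - real b') = (1 - y) * (real a' - real a)"
    using assms \<open>b' < b\<close> by (simp add: d_def algebra_simps of_nat_diff)
  then have x: "?x = (1 - y) * real a' + y * real b'" by (simp add: algebra_simps)
  \<comment> \<open>The crossing avoids the short sides: \<open>b > b'\<close> gives
    \<open>b > 0\<close>, and \<open>a < a'\<close> gives \<open>a < n\<close>.\<close>
  have "0 < y * real b" using y \<open>b' < b\<close> by simp
  moreover have "0 \<le> (1 - y) * real a" using y by simp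
  ultimately have "0 < ?x" by linarith
  moreover have "(1 - y) * real a < (1 - y) * real n" "y * real b \<le> y * real n"
    using y assms by auto
  then have "?x < real n" by (simp add: algebra_simps)
  ultimately have "(?x, y) \<in> interior (rectangle n)" using y by (simp add: interior_rectangle)
  moreover have "(?x, y) \<in> transversal a b" "(?x, y) \<in> transversal a' b'"
    using y x by (simp_all add: mem_transversal)
  ultimately show "\<exists>p \<in> interior (rectangle n). p \<in> transversal a b \<and> p \<in> transversal a' b'"
    by blast
qed

text \<open>Unordered pairs are encoded as two-element sets, to match the two-element subsets of
  \<open>chords_through n p\<close> that the binomial coefficient counts.\<close>

definition crossing_pairs :: "nat \<Rightarrow> (real \<times> real) set set set" where
  "crossing_pairs n = {U. U \<subseteq> transversals n \<and> card U = 2 \<and>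
     (\<exists>p \<in> interior (rectangle n). \<forall>s \<in> U. p \<in> s)}"

lemma card_crossing_pairs: "card (crossing_pairs n) = ((n + 1) choose 2)^2"
proof -
  let ?I = "{(a, a'). a < a' \<and> a' \<le> n}"
  \<comment> \<open>The smaller lower point is joined to the larger upper point. Writing the upper
    pair as \<open>(b', b)\<close> makes both components increasing pairs.\<close>
  let ?f = "\<lambda>((a, a'), (b', b)). {transversal a b, transversal a' b'}"
  have "crossing_pairs n = ?f ` (?I \<times> ?I)"
  proof (intro equalityI subsetI)
    fix U assume "U \<in> crossing_pairs n"
    then obtain p where p: "U \<subseteq> transversals n" "card U = 2" "p \<in> interior (rectangle n)"
        "\<forall>s\<in>U. p \<in> s"
      unfolding crossing_pairs_def by blast
    then obtain s s' where "U = {s, s'}" "s \<noteq> s'" by (metis card_2_iff)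
    with p have U: "U = {s, s'}" "s \<noteq> s'" "s \<in> transversals n" "s' \<in> transversals n"
        "p \<in> interior (rectangle n)" "p \<in> s" "p \<in> s'"
      by auto
    obtain a b where s: "s = transversal a b" "a \<le> n" "b \<le> n"
      using U(3) by (auto simp: transversals_def)
    obtain a' b' where s': "s' = transversal a' b'" "a' \<le> n" "b' \<le> n"
      using U(4) by (auto simp: transversals_def)
    \<comment> \<open>Two transversals with the same lower end that meet again at positive height
      coincide.\<close>
    have "a \<noteq> a'"
    proof
      assume "a = a'"
      moreover obtain x y where "p = (x, y)" "0 < y" "y < 1"
        using U by (auto simp: interior_rectangle)
      ultimately show False using U s s' by (auto simp: mem_transversal)
    qed
    then consider "a < a'" | "a' < a" by linarith
    then show "U \<in> ?f ` (?I \<times> ?I)"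
    proof cases
      case 1
      then have "b' < b" using transversals_cross_iff[of a n b a' b'] U s s' by auto
      then have "((a, a'), (b', b)) \<in> ?I \<times> ?I" "U = ?f ((a, a'), (b', b))" using 1 U s s' by auto
      then show ?thesis by blast
    next
      case 2
      then have "b < b'" using transversals_cross_iff[of a' n b' a b] U s s' by auto
      then have "((a', a), (b, b')) \<in> ?I \<times> ?I" "U = ?f ((a', a), (b, b'))" using 2 U s s' by auto
      then show ?thesis by blast
    qed
  next
    fix U assume "U \<in> ?f ` (?I \<times> ?I)"
    then obtain a a' b' b where ab: "a < a'" "a' \<le> n" "b' < b" "b \<le> n"
        "U = {transversal a b, transversal a' b'}"
      by auto
    then have "\<exists>p \<in> interior (rectangle n). p \<in> transversal a b \<and> p \<in> transversal a' b'"
      by (subst transversals_cross_iff) auto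
    moreover have "transversal a b \<noteq> transversal a' b'" using ab by (simp add: transversal_eq_iff)
    moreover have "transversal a b \<in> transversals n" "transversal a' b' \<in> transversals n"
      using ab by (auto simp: transversals_def)
    ultimately show "U \<in> crossing_pairs n" using ab by (simp add: crossing_pairs_def)
  qed
  \<comment> \<open>The increasing order of the lower points excludes matching the two chords the
    other way round.\<close>
  moreover have "inj_on ?f (?I \<times> ?I)"
    by (auto simp: inj_on_def doubleton_eq_iff transversal_eq_iff)
  ultimately show ?thesis
    by (simp add: card_image card_cartesian_product card_increasing_pairs
        power2_eq_square)
qed

text \<open>The sets \<open>?X p\<close> partition the crossing pairs by their crossing point; they
  are disjoint because two distinct transversals share at most one point.\<close>

lemma sum_choose_chords_through:
  "(\<Sum>p\<in>interior_nodes n. card (chords_through n p) choose 2) = ((n + 1) choose 2)^2"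
proof -
  let ?X = "\<lambda>p. {U. U \<subseteq> chords_through n p \<and> card U = 2}"
  have fin: "finite (chords_through n p)" for p
    by (simp add: chords_through_def finite_chords)
  have sub: "U \<subseteq> transversals n \<and> (\<forall>s\<in>U. p \<in> s)"
    if "p \<in> interior_nodes n" "U \<subseteq> chords_through n p" for p U
    using that by (auto simp: interior_nodes_def chords_through_interior)
  have "crossing_pairs n = (\<Union>p\<in>interior_nodes n. ?X p)"
  proof (intro equalityI subsetI)
    fix U assume "U \<in> crossing_pairs n"
    then obtain p where U: "U \<subseteq> transversals n" "card U = 2" "p \<in> interior (rectangle n)"
        "\<forall>s\<in>U. p \<in> s"
      by (auto simp: crossing_pairs_def)
    then have "U \<subseteq> chords_through n p" by (auto simp: chords_through_interior)
    \<comment> \<open>The two chords of \<open>U\<close> already supply the two chords required of a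
      node.\<close>
    moreover from this have "p \<in> interior_nodes n"
      using U card_mono[of "chords_through n p" U] fin by (simp add: interior_nodes_def)
    ultimately show "U \<in> (\<Union>p\<in>interior_nodes n. ?X p)" using U by blast
  next
    fix U assume "U \<in> (\<Union>p\<in>interior_nodes n. ?X p)"
    then obtain p where p: "p \<in> interior_nodes n" "U \<subseteq> chords_through n p" "card U = 2" by blast
    then have "p \<in> interior (rectangle n)" by (simp add: interior_nodes_def)
    with sub[OF p(1,2)] p(3) show "U \<in> crossing_pairs n" unfolding crossing_pairs_def by blast
  qed
  moreover have "?X p \<inter> ?X q = {}" if "p \<in> interior_nodes n" "q \<in> interior_nodes n" "p \<noteq> q" for p q
  proof (rule ccontr)
    assume "?X p \<inter> ?X q \<noteq> {}"
    then obtain U where U: "U \<subseteq> chords_through n p" "U \<subseteq> chords_through n q" "card U = 2" by auto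
    then obtain s s' where "U = {s, s'}" "s \<noteq> s'" by (auto simp: card_2_iff)
    then show False
      using sub[OF that(1) U(1)] sub[OF that(2) U(2)] that(3) interior_nodes_eqI[of s n s' p q]
      by auto
  qed
  ultimately have "card (crossing_pairs n) = (\<Sum>p\<in>interior_nodes n. card (?X p))"
    using fin by (simp add: card_UN_disjoint finite_interior_nodes)
  then show ?thesis by (simp add: card_crossing_pairs n_subsets[OF fin])
qed

theorem theorem5p1:
  fixes n :: nat
  assumes "n \<ge> 2"
  shows "(\<Sum>c = 2..n+1. num_crossings n c) + 2 * n + 2 = num_nodes n
    \<and> (\<Sum>c = 2..n+1. c * num_crossings n c) + n ^ 2 + 4 * n + 1 = num_edges n
    \<and> (\<Sum>c = 2..n+1. (c choose 2) * num_crossings n c) = ((n + 1) choose 2) ^ 2"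
  \<comment> \<open>The weights \<open>1\<close>, \<open>c\<close> and \<open>c choose 2\<close>
    yield the three left-hand sums in turn.\<close>
  using sum_num_crossings[of "\<lambda>_. 1" n] sum_num_crossings[of "\<lambda>c. c" n]
    sum_num_crossings[of "\<lambda>c. c choose 2" n] num_nodes_eq[of n] num_edges_eq[of n]
    sum_choose_chords_through[of n] assms
  by simp

end
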